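(* Let $\mathcal{P}$ be a nonempty convex set of Borel probability measures on a Polish space $\Omega$, let $S_0\in\mathbb{R}^d$, let $S_1:\Omega\to\mathbb{R}^d$ be Borel measurable, $\Delta S:=S_1-S_0$, let $\mathcal{H}\subset\mathbb{R}^d$ be nonempty, and let $f:\Omega\to\mathbb{R}$ be universally measurable. Assume that $\mathcal{C}_{\mathcal{H}}(\mathcal{P})$ is closed, that $\mathcal{H}(\mathcal{P})$ is convex and closed, and that NA$(\mathcal{P})$ holds. Define $$\pi^{\mathcal{P}}(f):=\inf\{x:\ \exists H\in\mathcal{H}\text{ s.t. }x+H\Delta S\ge f\ \mathcal{P}\text{-q.s.}\},$$ $$\mathfrak{Q}:=\{Q\in\mathfrak{P}(\Omega):\ Q\lll\mathcal{P},\ E_Q|\Delta S|<\infty,\ A^Q:=\sup_{H\in\mathcal{H}}E_Q[H\Delta S]<\infty\}.$$ Then $$\pi^{\mathcal{P}}(f)=\sup_{Q\in\mathfrak{Q}}(E_Q[f]-A^Q).$$ Besides, $\pi^{\mathcal{P}}(f)>-\infty$ and there exists $H\in\mathcal{H}$ such that $\pi^{\mathcal{P}}(f)+H\Delta S\ge f$ $\mathcal{P}$-q.s.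
   Context: $\mathfrak{P}(\Omega)$ is the set of Borel probability measures on $\Omega$. $H\Delta S$ is the Euclidean inner product. A property holds $\mathcal{P}$-q.s. if it holds $P$-a.s. for every $P\in\mathcal{P}$. $Q\lll\mathcal{P}$ means $Q\ll P$ for some $P\in\mathcal{P}$. NA$(\mathcal{P})$: for every $H\in\mathcal{H}$, if $H\Delta S\ge 0$ $\mathcal{P}$-q.s. then $H\Delta S=0$ $\mathcal{P}$-q.s. Expectations are extended: $E_Q[X]:=E_Q[X^+]-E_Q[X^-]$ with $\infty-\infty:=-\infty$; $\inf\emptyset=\infty$. $\mathrm{supp}_{\mathcal{P}}(\Delta S)$ is the smallest closed $A\subset\mathbb{R}^d$ with $\Delta S\in A$ $\mathcal{P}$-q.s.; $N^\perp(\mathcal{P}):=\mathrm{span}(\mathrm{supp}_{\mathcal{P}}(\Delta S))$. $\mathcal{H}(\mathcal{P})$ is the orthogonal projection of $\mathcal{H}$ onto $N^\perp(\mathcal{P})$, and $\mathcal{C}_{\mathcal{H}}(\mathcal{P}):=\{cH: H\in\mathcal{H}(\mathcal{P}),\ c\ge 0\}$. *)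

theory Defs
  imports "HOL-Probability.Probability"
begin

definition qs :: "'w measure set \<Rightarrow> ('w \<Rightarrow> bool) \<Rightarrow> bool"
  where "qs \<P> \<phi> \<longleftrightarrow> (\<forall>P\<in>\<P>. AE \<omega> in P. \<phi> \<omega>)"

(* Type 'w measure carries no vector space structure, so convexity is spelled out.  For
   measures on the Borel sets the mixture R is determined by its values on those sets. *)
definition convex_measures :: "'w::topological_space measure set \<Rightarrow> bool"
  where "convex_measures \<P> \<longleftrightarrow>
    (\<forall>P\<in>\<P>. \<forall>Q\<in>\<P>. \<forall>t\<in>{0..1}. \<exists>R\<in>\<P>. \<forall>A\<in>sets borel.
        measure R A = t * measure P A + (1 - t) * measure Q A)"

(* The universal sigma-algebra is the intersection of the completions of the Borel sets
   over all Borel probability measures. *)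
definition universally_measurable :: "('w::topological_space \<Rightarrow> real) \<Rightarrow> bool"
  where "universally_measurable f \<longleftrightarrow>
    (\<forall>P\<in>space (prob_algebra (borel :: 'w measure)). f \<in> borel_measurable (completion P))"

(* E[X^+] - E[X^-], where ennreal truncates negative reals to 0.  Integration is against the
   completion so that universally measurable X are covered.  The case distinction
   is needed because \<infinity> - \<infinity> = \<infinity> in type ereal. *)
definition ext_expect :: "'w measure \<Rightarrow> ('w \<Rightarrow> real) \<Rightarrow> ereal"
  where "ext_expect Q X =
    (let p = (\<integral>\<^sup>+ \<omega>. ennreal (X \<omega>) \<partial>completion Q);
         n = (\<integral>\<^sup>+ \<omega>. ennreal (- X \<omega>) \<partial>completion Q)
     in if p = \<infinity> \<and> n = \<infinity> then -\<infinity> else enn2ereal p - enn2ereal n)"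

definition no_arbitrage ::
    "'w measure set \<Rightarrow> 'e::real_inner set \<Rightarrow> ('w \<Rightarrow> 'e) \<Rightarrow> bool"
  where "no_arbitrage \<P> \<H> \<Delta>S \<longleftrightarrow>
    (\<forall>H\<in>\<H>. qs \<P> (\<lambda>\<omega>. H \<bullet> \<Delta>S \<omega> \<ge> 0) \<longrightarrow> qs \<P> (\<lambda>\<omega>. H \<bullet> \<Delta>S \<omega> = 0))"

definition qs_support :: "'w measure set \<Rightarrow> ('w \<Rightarrow> 'e::topological_space) \<Rightarrow> 'e set"
  where "qs_support \<P> \<Delta>S = (LEAST A. closed A \<and> qs \<P> (\<lambda>\<omega>. \<Delta>S \<omega> \<in> A))"

lemma
  fixes \<Delta>S :: "'w \<Rightarrow> 'e::second_countable_topology"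
  shows qs_support_eq: "qs_support \<P> \<Delta>S = \<Inter>{A. closed A \<and> qs \<P> (\<lambda>\<omega>. \<Delta>S \<omega> \<in> A)}"
    and closed_qs_support: "closed (qs_support \<P> \<Delta>S)"
    and qs_in_qs_support: "qs \<P> (\<lambda>\<omega>. \<Delta>S \<omega> \<in> qs_support \<P> \<Delta>S)"
    and qs_support_least:
      "\<lbrakk>closed A; qs \<P> (\<lambda>\<omega>. \<Delta>S \<omega> \<in> A)\<rbrakk> \<Longrightarrow> qs_support \<P> \<Delta>S \<subseteq> A"
proof -
  define F where "F = {A. closed A \<and> qs \<P> (\<lambda>\<omega>. \<Delta>S \<omega> \<in> A)}"
  have cl: "closed (\<Inter>F)" unfolding F_def by auto
  have "\<And>U. U \<in> uminus ` F \<Longrightarrow> open U" unfolding F_def by auto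
  then obtain G where G: "G \<subseteq> uminus ` F" "countable G" "\<Union>G = \<Union>(uminus ` F)"
    using Lindelof by metis
  have sub: "\<Inter>(uminus ` G) = \<Inter>F" using G(3) by auto
  have "qs \<P> (\<lambda>\<omega>. \<Delta>S \<omega> \<in> \<Inter>(uminus ` G))"
    unfolding qs_def
  proof
    fix P assume P: "P \<in> \<P>"
    have "AE \<omega> in P. \<forall>U\<in>G. \<Delta>S \<omega> \<in> - U"
      using G(1) P by (subst AE_ball_countable[OF G(2)]) (auto simp: F_def qs_def)
    then show "AE \<omega> in P. \<Delta>S \<omega> \<in> \<Inter>(uminus ` G)" by eventually_elim auto
  qed
  then have as: "qs \<P> (\<lambda>\<omega>. \<Delta>S \<omega> \<in> \<Inter>F)" unfolding sub .
  have eq: "qs_support \<P> \<Delta>S = \<Inter>F" unfolding qs_support_def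
    by (rule Least_equality) (use cl as in \<open>auto simp: F_def\<close>)
  show "qs_support \<P> \<Delta>S = \<Inter>{A. closed A \<and> qs \<P> (\<lambda>\<omega>. \<Delta>S \<omega> \<in> A)}"
    using eq unfolding F_def .
  show "closed (qs_support \<P> \<Delta>S)" "qs \<P> (\<lambda>\<omega>. \<Delta>S \<omega> \<in> qs_support \<P> \<Delta>S)"
    using cl as unfolding eq by auto
  show "qs_support \<P> \<Delta>S \<subseteq> A" if "closed A" "qs \<P> (\<lambda>\<omega>. \<Delta>S \<omega> \<in> A)"
    using that unfolding eq by (auto simp: F_def)
qed

definition N_perp :: "'w measure set \<Rightarrow> ('w \<Rightarrow> 'e::euclidean_space) \<Rightarrow> 'e set"
  where "N_perp \<P> \<Delta>S = span (qs_support \<P> \<Delta>S)"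

definition orth_proj :: "'e::euclidean_space set \<Rightarrow> 'e \<Rightarrow> 'e"
  where "orth_proj V x = (THE p. p \<in> V \<and> (\<forall>v\<in>V. orthogonal (x - p) v))"

lemma
  assumes V: "subspace V"
  shows orth_proj_in: "orth_proj V x \<in> V"
    and orth_proj_orthogonal: "v \<in> V \<Longrightarrow> orthogonal (x - orth_proj V x) v"
    and orth_proj_unique:
      "\<lbrakk>p \<in> V; \<forall>v\<in>V. orthogonal (x - p) v\<rbrakk> \<Longrightarrow> orth_proj V x = p"
proof -
  let ?R = "\<lambda>p. p \<in> V \<and> (\<forall>v\<in>V. orthogonal (x - p) v)"
  obtain y z where yz: "y \<in> span V" "\<And>w. w \<in> span V \<Longrightarrow> orthogonal z w" "x = y + z"
    using orthogonal_subspace_decomp_exists[of V x] by metis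
  have y: "?R y" using yz V by (simp add: span_eq_iff[THEN iffD2])
  have un: "p = q" if "?R p" "?R q" for p q
  proof -
    have "p - q \<in> V" using that V by (simp add: subspace_diff)
    then have "(x - p) \<bullet> (p - q) = 0" "(x - q) \<bullet> (p - q) = 0"
      using that by (auto simp: orthogonal_def)
    then have "(p - q) \<bullet> (p - q) = 0" by (simp add: inner_diff_left)
    then show ?thesis by simp
  qed
  have ex: "?R (orth_proj V x)" unfolding orth_proj_def
    by (rule theI[of ?R, OF y]) (use un y in blast)
  show "orth_proj V x \<in> V" "v \<in> V \<Longrightarrow> orthogonal (x - orth_proj V x) v" using ex by auto
  show "\<lbrakk>p \<in> V; \<forall>v\<in>V. orthogonal (x - p) v\<rbrakk> \<Longrightarrow> orth_proj V x = p"
    using un ex by blast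
qed

definition H_proj ::
    "'w measure set \<Rightarrow> 'e set \<Rightarrow> ('w \<Rightarrow> 'e::euclidean_space) \<Rightarrow> 'e set"
  where "H_proj \<P> \<H> \<Delta>S = orth_proj (N_perp \<P> \<Delta>S) ` \<H>"

definition C_cone ::
    "'w measure set \<Rightarrow> 'e set \<Rightarrow> ('w \<Rightarrow> 'e::euclidean_space) \<Rightarrow> 'e set"
  where "C_cone \<P> \<H> \<Delta>S = {c *\<^sub>R H | c H. H \<in> H_proj \<P> \<H> \<Delta>S \<and> c \<ge> 0}"

definition superhedging_price ::
    "'w measure set \<Rightarrow> 'e::real_inner set \<Rightarrow> ('w \<Rightarrow> 'e) \<Rightarrow> ('w \<Rightarrow> real) \<Rightarrow> ereal"
  where "superhedging_price \<P> \<H> \<Delta>S f =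
    Inf (ereal ` {x. \<exists>H\<in>\<H>. qs \<P> (\<lambda>\<omega>. x + H \<bullet> \<Delta>S \<omega> \<ge> f \<omega>)})"

definition penalty :: "'e::real_inner set \<Rightarrow> ('w \<Rightarrow> 'e) \<Rightarrow> 'w measure \<Rightarrow> ereal"
  where "penalty \<H> \<Delta>S Q = (SUP H\<in>\<H>. ext_expect Q (\<lambda>\<omega>. H \<bullet> \<Delta>S \<omega>))"

definition dual_measures ::
    "'w::topological_space measure set \<Rightarrow> 'e::real_inner set \<Rightarrow> ('w \<Rightarrow> 'e) \<Rightarrow> 'w measure set"
  where "dual_measures \<P> \<H> \<Delta>S =
    {Q \<in> space (prob_algebra borel).
       (\<exists>P\<in>\<P>. absolutely_continuous P Q) \<and>
       ext_expect Q (\<lambda>\<omega>. norm (\<Delta>S \<omega>)) < \<infinity> \<and>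
       penalty \<H> \<Delta>S Q < \<infinity>}"

end

theory Submission
  imports Defs
begin

text \<open>Write \<open>K\<close> for the projected strategies \<open>H_proj\<close>.  Projecting onto the span of the support does
not change any gain \<open>H \<bullet> \<Delta>S\<close> outside a polar set (one that is null under every element of \<open>\<P>\<close>),
so superhedging with \<open>\<H>\<close> is superhedging with \<open>K\<close>;
and on that span only the zero vector has a gain that vanishes quasi-surely, so the absence of
arbitrage says that \<open>0\<close> is the only element of the cone over \<open>K\<close> with a nonnegative gain
(\<open>no_arbitrage_cone\<close>).

The set \<open>K\<close> is in general neither bounded nor a cone.  Both defects disappear after homogenising:
let \<open>C\<close> be the closed convex cone generated by the pairs \<open>(k, 1)\<close> with \<open>k \<in> K\<close>, and let
\<open>W\<^sub>x = (- \<Delta>S, f - x)\<close>.  Then \<open>k\<close> superhedges \<open>f\<close> from initial capital \<open>x\<close> exactly if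
\<open>(k, 1) \<bullet> W\<^sub>x \<le> 0\<close> quasi-surely.  Closing the cone adds directions \<open>(h, 0)\<close> only, with \<open>h\<close> in the closed cone
over \<open>K\<close>, and for those \<open>(h, 0) \<bullet> W\<^sub>x \<le> 0\<close> would be an arbitrage.  Hence \<open>x\<close> suffices for superhedging
exactly if some nonzero \<open>a \<in> C\<close> has \<open>a \<bullet> W\<^sub>x \<le> 0\<close> quasi-surely (\<open>superhedge_of_homogenization\<close>).

This criterion gives attainment by compactness.  For each sufficient capital \<open>x\<close> the unit vectors
\<open>a \<in> C\<close> with \<open>a \<bullet> W\<^sub>x \<le> 0\<close> form a nonempty compact set, and these sets shrink as \<open>x\<close> decreases.  A common
point of all of them is a single strategy that superhedges from every sufficient capital, hence from
their infimum; as \<open>f\<close> is real-valued, this also forces the infimum to exceed \<open>-\<infinity>\<close>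
(\<open>superhedge_attained\<close>).

It also gives duality by separation in a finite-dimensional space.  Let \<open>x\<close> be below the price and
let \<open>M\<close> be the set of vectors \<open>E\<^sub>Q W\<^sub>x\<close>, where \<open>Q\<close> is absolutely continuous with respect to some element
of \<open>\<P>\<close> and \<open>W\<^sub>x\<close> is \<open>Q\<close>-integrable; it is convex because \<open>\<P>\<close> is (\<open>convex_moments\<close>).  If \<open>M\<close> missed the dual
cone of \<open>C\<close>, a hyperplane would separate the two, with a normal vector \<open>a \<noteq> 0\<close> that lies in the
bidual of \<open>C\<close>, which is \<open>C\<close>, and satisfies \<open>a \<bullet> E\<^sub>Q W\<^sub>x \<le> 0\<close> for all these \<open>Q\<close>.  Such \<open>Q\<close> can be concentrated
on any event that is not polar, so \<open>a \<bullet> W\<^sub>x \<le> 0\<close> quasi-surely, contrary to the criterion.  Hence some \<open>Q\<close>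
has \<open>E\<^sub>Q W\<^sub>x\<close> in the dual cone (\<open>ex_moment_in_dual_cone\<close>); tested against \<open>(k, 1)\<close> this reads
\<open>E\<^sub>Q[k \<bullet> \<Delta>S] \<le> E\<^sub>Q[f] - x\<close> for all \<open>k \<in> K\<close>, so \<open>Q\<close> has finite penalty and
dual value at least \<open>x\<close> (\<open>dual_measure_above\<close>).\<close>

section \<open>Mixtures and concentrated densities\<close>

text \<open>Tossing a coin with bias \<open>t\<close> and then sampling from \<open>Q1\<close> or \<open>Q2\<close> realises the mixture as a monadic bind.\<close>

lemma mixture_of_prob_measures:
  fixes M :: "'a measure" and t :: real
  assumes "Q1 \<in> space (prob_algebra M)" "Q2 \<in> space (prob_algebra M)" "0 \<le> t" "t \<le> 1"
  obtains R where "R \<in> space (prob_algebra M)"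
    and "\<And>h. h \<in> borel_measurable M \<Longrightarrow>
      (\<integral>\<^sup>+x. h x \<partial>R) = ennreal t * (\<integral>\<^sup>+x. h x \<partial>Q1) + ennreal (1 - t) * (\<integral>\<^sup>+x. h x \<partial>Q2)"
proof
  let ?k = "\<lambda>b. if b then Q1 else Q2"
  let ?R = "measure_pmf (bernoulli_pmf t) \<bind> ?k"
  have k: "?k \<in> measure_pmf (bernoulli_pmf t) \<rightarrow>\<^sub>M prob_algebra M"
    using assms by auto
  have coin: "measure_pmf (bernoulli_pmf t) \<in> space (prob_algebra (count_space UNIV))"
    by (simp add: space_prob_algebra measure_pmf.prob_space_axioms)
  have k': "?k \<in> count_space UNIV \<rightarrow>\<^sub>M prob_algebra M"
    using assms by auto
  show "?R \<in> space (prob_algebra M)"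
    using prob_space_bind'[OF coin k'] sets_bind'[OF coin k'] by (simp add: space_prob_algebra)
  fix h :: "'a \<Rightarrow> ennreal" assume h: "h \<in> borel_measurable M"
  show "(\<integral>\<^sup>+x. h x \<partial>?R)
      = ennreal t * (\<integral>\<^sup>+x. h x \<partial>Q1) + ennreal (1 - t) * (\<integral>\<^sup>+x. h x \<partial>Q2)"
    using assms by (simp add: nn_integral_bind[OF h measurable_prob_algebraD[OF k]] mult.commute)
qed

text \<open>The mixture is known through nonnegative functions only; scalar functions are split into
positive and negative parts, and vector-valued ones are tested against all directions \<open>b\<close>.\<close>

lemma integral_mixture:
  fixes g :: "'a \<Rightarrow> 'e::euclidean_space" and t :: real
  assumes mix: "\<And>h. h \<in> borel_measurable M \<Longrightarrow>
      (\<integral>\<^sup>+x. h x \<partial>R) = ennreal t * (\<integral>\<^sup>+x. h x \<partial>Q1) + ennreal (1 - t) * (\<integral>\<^sup>+x. h x \<partial>Q2)"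
    and sets: "sets R = sets M" "sets Q1 = sets M" "sets Q2 = sets M"
    and t: "0 \<le> t" "t \<le> 1"
    and int: "integrable Q1 g" "integrable Q2 g"
  shows "integrable R g"
    and "integral\<^sup>L R g = t *\<^sub>R integral\<^sup>L Q1 g + (1 - t) *\<^sub>R integral\<^sup>L Q2 g"
proof -
  have g: "g \<in> borel_measurable M"
    using int(1) borel_measurable_integrable measurable_cong_sets[OF sets(2) refl] by blast
  have meas: "h \<in> borel_measurable R" if "h \<in> borel_measurable M" for h :: "'a \<Rightarrow> 'e"
    using that measurable_cong_sets[OF sets(1) refl] by blast
  have "(\<integral>\<^sup>+x. norm (g x) \<partial>R) < \<infinity>"
    using int g by (simp add: mix integrable_iff_bounded ennreal_mult_less_top)
  then show R: "integrable R g"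
    using meas[OF g] by (simp add: integrable_iff_bounded)
  have "b \<bullet> integral\<^sup>L R g = b \<bullet> (t *\<^sub>R integral\<^sup>L Q1 g + (1 - t) *\<^sub>R integral\<^sup>L Q2 g)" for b
  proof -
    have i: "integrable Q1 (\<lambda>x. b \<bullet> g x)" "integrable Q2 (\<lambda>x. b \<bullet> g x)" "integrable R (\<lambda>x. b \<bullet> g x)"
      using int R by auto
    have fin: "(\<integral>\<^sup>+x. ennreal (b \<bullet> g x) \<partial>Q) < \<top>" "(\<integral>\<^sup>+x. ennreal (- (b \<bullet> g x)) \<partial>Q) < \<top>"
      if "integrable Q (\<lambda>x. b \<bullet> g x)" for Q
      using that unfolding real_integrable_def by (auto simp: less_top)
    have split: "enn2real (\<integral>\<^sup>+x. h x \<partial>R)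
        = t * enn2real (\<integral>\<^sup>+x. h x \<partial>Q1) + (1 - t) * enn2real (\<integral>\<^sup>+x. h x \<partial>Q2)"
      if "h \<in> borel_measurable M" "(\<integral>\<^sup>+x. h x \<partial>Q1) < \<top>" "(\<integral>\<^sup>+x. h x \<partial>Q2) < \<top>" for h
      using that t by (simp add: mix enn2real_plus ennreal_mult_less_top enn2real_mult)
    have "(\<integral>x. b \<bullet> g x \<partial>R) = t * (\<integral>x. b \<bullet> g x \<partial>Q1) + (1 - t) * (\<integral>x. b \<bullet> g x \<partial>Q2)"
      unfolding real_lebesgue_integral_def[OF i(1)] real_lebesgue_integral_def[OF i(2)]
        real_lebesgue_integral_def[OF i(3)]
      using fin[OF i(1)] fin[OF i(2)] g
      by (subst (1 2) split) (auto simp: algebra_simps)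
    then show ?thesis using int R by (simp add: inner_add_right)
  qed
  then show "integral\<^sup>L R g = t *\<^sub>R integral\<^sup>L Q1 g + (1 - t) *\<^sub>R integral\<^sup>L Q2 g"
    using vector_eq_rdot by (metis inner_commute)
qed

text \<open>The density is the normalisation of \<open>1\<^sub>B / (1 + \<bar>g\<bar>)\<close>: the indicator concentrates the measure on \<open>B\<close>,
and the denominator makes the density times \<open>g\<close> bounded.\<close>

lemma prob_density_concentrated:
  fixes g :: "'a \<Rightarrow> 'e::euclidean_space"
  assumes P: "prob_space P" and g[measurable]: "g \<in> borel_measurable P"
    and B[measurable]: "B \<in> sets P" and pos: "\<not> (AE x in P. x \<notin> B)"
  obtains Q where "prob_space Q" "sets Q = sets P" "absolutely_continuous P Q" "integrable Q g"
    and "AE x in Q. x \<in> B"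
proof -
  interpret P: prob_space P by (rule P)
  define z where "z x = indicator B x / (1 + norm (g x))" for x
  have z0: "0 \<le> z x" and z1: "z x \<le> 1" and zg: "z x * norm (g x) \<le> 1" for x
    unfolding z_def using norm_ge_zero[of "g x"]
    by (auto simp: indicator_def divide_simps add_nonneg_eq_0_iff not_less simp del: norm_ge_zero)
  have zm[measurable]: "z \<in> borel_measurable P" unfolding z_def by measurable
  have zi: "integrable P z"
    by (rule P.integrable_const_bound[of _ 1]) (use z0 z1 in auto)
  define c where "c = (\<integral>x. z x \<partial>P)"
  have "c \<noteq> 0"
  proof
    assume "c = 0"
    then have "AE x in P. z x = 0"
      using integral_nonneg_eq_0_iff_AE[OF zi] z0 by (simp add: c_def)
    then have "AE x in P. x \<notin> B"
    proof eventually_elim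
      case (elim x)
      then show ?case using norm_ge_zero[of "g x"] unfolding z_def by (auto simp: indicator_def split: if_splits)
    qed
    with pos show False by simp
  qed
  moreover have "c \<ge> 0" unfolding c_def using z0 by simp
  ultimately have c: "c > 0" by simp
  define Q where "Q = density P (\<lambda>x. ennreal (z x / c))"
  show thesis
  proof
    have "emeasure Q (space Q) = ennreal (\<integral>x. z x / c \<partial>P)"
      unfolding Q_def using z0 c zi
      by (simp add: emeasure_density nn_integral_eq_integral cong: nn_integral_cong)
    also have "\<dots> = 1" using c by (simp add: c_def[symmetric])
    finally show "prob_space Q" by (rule prob_spaceI)
    show "sets Q = sets P" by (simp add: Q_def)
    show "absolutely_continuous P Q"
      unfolding Q_def by (rule absolutely_continuousI_density) measurable
    have "integrable P (\<lambda>x. (z x / c) *\<^sub>R g x)"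
      using z0 zg c by (intro P.integrable_const_bound[of _ "1 / c"]) (auto simp: divide_simps)
    then show "integrable Q g"
      unfolding Q_def using z0 c by (subst integrable_density) auto
    show "AE x in Q. x \<in> B"
      unfolding Q_def by (subst AE_density) (auto simp: z_def indicator_def)
  qed
qed

section \<open>Moments against dominated measures\<close>

text \<open>A hyperplane that separates a point from a cone can be moved to the origin: a linear functional that is
bounded below on a cone is nonnegative on it.\<close>

lemma closed_convex_cone_bidual:
  fixes C :: "'e::euclidean_space set"
  assumes "convex C" "closed C" "cone C" "C \<noteq> {}"
    and a: "\<And>v. (\<And>c. c \<in> C \<Longrightarrow> 0 \<le> c \<bullet> v) \<Longrightarrow> 0 \<le> a \<bullet> v"
  shows "a \<in> C"
proof (rule ccontr)
  assume "a \<notin> C"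
  then obtain v \<beta> where v: "v \<bullet> a < \<beta>" "\<And>c. c \<in> C \<Longrightarrow> v \<bullet> c > \<beta>"
    using separating_hyperplane_closed_point[OF assms(1,2)] by metis
  have "0 \<in> C" using cone_contains_0[OF assms(3)] assms(4) by simp
  then have \<beta>: "\<beta> < 0" using v(2)[of 0] by simp
  have "0 \<le> c \<bullet> v" if "c \<in> C" for c
  proof (rule ccontr)
    assume neg: "\<not> 0 \<le> c \<bullet> v"
    then have "(\<beta> / (c \<bullet> v)) *\<^sub>R c \<in> C"
      using \<beta> that by (intro mem_cone[OF assms(3)]) (auto simp: divide_nonpos_neg)
    then have "v \<bullet> ((\<beta> / (c \<bullet> v)) *\<^sub>R c) > \<beta>" by (rule v(2))
    then show False using neg by (simp add: inner_commute)
  qed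
  then have "0 \<le> a \<bullet> v" by (rule a)
  then show False using v(1) \<beta> by (simp add: inner_commute)
qed

definition dominated :: "'w::topological_space measure set \<Rightarrow> 'w measure set"
  where "dominated \<P> = {Q \<in> space (prob_algebra borel). \<exists>P\<in>\<P>. absolutely_continuous P Q}"

text \<open>Universal measurability in the form in which it is used.  The Borel version depends on the measure.\<close>

definition has_borel_versions :: "('w::topological_space \<Rightarrow> 'e::topological_space) \<Rightarrow> bool"
  where "has_borel_versions W \<longleftrightarrow>
    (\<forall>Q\<in>space (prob_algebra borel). \<exists>g\<in>borel_measurable borel. AE \<omega> in Q. W \<omega> = g \<omega>)"

text \<open>The expectations of \<open>W\<close> under dominated measures.  Integrals are taken of Borel versions, since \<open>W\<close> itself
need not be measurable for the Borel \<open>\<sigma>\<close>-algebra.\<close>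

definition moments :: "'w::topological_space measure set \<Rightarrow> ('w \<Rightarrow> 'e::euclidean_space) \<Rightarrow> 'e set"
  where "moments \<P> W =
    {integral\<^sup>L Q g | Q g. Q \<in> dominated \<P> \<and> integrable Q g \<and> (AE \<omega> in Q. W \<omega> = g \<omega>)}"

lemma momentsI:
  "Q \<in> dominated \<P> \<Longrightarrow> integrable Q g \<Longrightarrow> AE \<omega> in Q. W \<omega> = g \<omega> \<Longrightarrow> integral\<^sup>L Q g \<in> moments \<P> W"
  unfolding moments_def by blast

lemma dominated_AE:
  assumes "Q \<in> dominated \<P>" "\<P> \<subseteq> space (prob_algebra borel)" "qs \<P> \<phi>"
  shows "AE \<omega> in Q. \<phi> \<omega>"
proof -
  obtain P where P: "P \<in> \<P>" "absolutely_continuous P Q" and Q: "Q \<in> space (prob_algebra borel)"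
    using assms(1) by (auto simp: dominated_def)
  have "sets Q = sets P" using P(1) Q assms(2) by (auto simp: space_prob_algebra)
  then show ?thesis
    using absolutely_continuous_AE[OF _ P(2)] assms(3) P(1) by (auto simp: qs_def)
qed

text \<open>A mixture of two dominated measures is dominated by the corresponding mixture in \<open>\<P>\<close>.  The Borel versions
of \<open>W\<close> under the two measures may differ, but a version under the mixture serves for both.\<close>

lemma convex_moments:
  assumes probs: "\<P> \<subseteq> space (prob_algebra borel)" and conv: "convex_measures \<P>"
    and W: "has_borel_versions W"
  shows "convex (moments \<P> W)"
  unfolding convex_alt
proof (intro ballI allI impI)
  fix y x and s :: real
  assume y: "y \<in> moments \<P> W" and x: "x \<in> moments \<P> W" and s: "0 \<le> s \<and> s \<le> 1"
  define t where "t = 1 - s"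
  have t: "0 \<le> t" "t \<le> 1" using s by (auto simp: t_def)
  show "(1 - s) *\<^sub>R y + s *\<^sub>R x \<in> moments \<P> W"
  proof (cases "0 < t \<and> t < 1")
    case False
    then have "t = 0 \<or> t = 1" using t by linarith
    then show ?thesis using x y by (auto simp: t_def)
  next
    case True
    obtain Q1 g1 where 1: "Q1 \<in> dominated \<P>" "integrable Q1 g1" "AE \<omega> in Q1. W \<omega> = g1 \<omega>" "y = integral\<^sup>L Q1 g1"
      using y by (auto simp: moments_def)
    obtain Q2 g2 where 2: "Q2 \<in> dominated \<P>" "integrable Q2 g2" "AE \<omega> in Q2. W \<omega> = g2 \<omega>" "x = integral\<^sup>L Q2 g2"
      using x by (auto simp: moments_def)
    have Q: "Q1 \<in> space (prob_algebra borel)" "Q2 \<in> space (prob_algebra borel)"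
      using 1 2 by (auto simp: dominated_def)
    obtain R where R: "R \<in> space (prob_algebra borel)"
      and mix: "\<And>h. h \<in> borel_measurable borel \<Longrightarrow> (\<integral>\<^sup>+x. h x \<partial>R) =
        ennreal t * (\<integral>\<^sup>+x. h x \<partial>Q1) + ennreal (1 - t) * (\<integral>\<^sup>+x. h x \<partial>Q2)"
      using mixture_of_prob_measures[OF Q t] by metis
    have sets: "sets R = sets borel" "sets Q1 = sets borel" "sets Q2 = sets borel"
      using R Q by (auto simp: space_prob_algebra)
    \<comment> \<open>This and the case distinction on \<open>t\<close> belong together: only a proper mixture charges everything
        that its components charge.\<close>
    have null_mix: "emeasure R A = 0 \<longleftrightarrow> emeasure Q1 A = 0 \<and> emeasure Q2 A = 0"
      if "A \<in> sets borel" for A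
      using mix[of "indicator A"] that True sets by (simp add: nn_integral_indicator)
    obtain P1 P2 where P: "P1 \<in> \<P>" "P2 \<in> \<P>" "absolutely_continuous P1 Q1" "absolutely_continuous P2 Q2"
      using 1 2 by (auto simp: dominated_def)
    obtain P where P0: "P \<in> \<P>"
      "\<And>A. A \<in> sets borel \<Longrightarrow> measure P A = t * measure P1 A + (1 - t) * measure P2 A"
      using conv P t unfolding convex_measures_def by (metis atLeastAtMost_iff)
    have Ps: "prob_space P" "prob_space P1" "prob_space P2"
      "sets P = sets borel" "sets P1 = sets borel" "sets P2 = sets borel"
      using probs P P0 by (auto simp: space_prob_algebra)
    have "absolutely_continuous P R"
      unfolding absolutely_continuous_def
    proof
      fix A assume A: "A \<in> null_sets P"
      then have Ab: "A \<in> sets borel" using Ps by auto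
      have "measure P A = 0" using A by (simp add: measure_eq_0_null_sets)
      then have "t * measure P1 A + (1 - t) * measure P2 A = 0"
        using P0(2)[OF Ab] by simp
      moreover have "0 \<le> t * measure P1 A" "0 \<le> (1 - t) * measure P2 A" using t by simp_all
      ultimately have "t * measure P1 A = 0 \<and> (1 - t) * measure P2 A = 0" by linarith
      then have "measure P1 A = 0" "measure P2 A = 0" using True by auto
      then have "A \<in> null_sets P1" "A \<in> null_sets P2"
        using Ps Ab by (auto simp: null_sets_def finite_measure.emeasure_eq_measure prob_space_def)
      then have "A \<in> null_sets Q1" "A \<in> null_sets Q2"
        using P by (auto simp: absolutely_continuous_def)
      then show "A \<in> null_sets R" using null_mix[OF Ab] Ab sets by (auto simp: null_sets_def)
    qed
    then have RD: "R \<in> dominated \<P>" using R P0 by (auto simp: dominated_def)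
    obtain g where g: "g \<in> borel_measurable borel" "AE \<omega> in R. W \<omega> = g \<omega>"
      using W R unfolding has_borel_versions_def by metis
    obtain N where N: "N \<in> null_sets R" "{\<omega> \<in> space R. W \<omega> \<noteq> g \<omega>} \<subseteq> N"
      using g(2) unfolding eventually_ae_filter by auto
    have "N \<in> null_sets Q1" "N \<in> null_sets Q2"
      using N(1) null_mix sets by (auto simp: null_sets_def)
    moreover have "space R = UNIV" "space Q1 = UNIV" "space Q2 = UNIV"
      using sets[THEN sets_eq_imp_space_eq] by simp_all
    ultimately have ae: "AE \<omega> in Q1. W \<omega> = g \<omega>" "AE \<omega> in Q2. W \<omega> = g \<omega>"
      using N(2) unfolding eventually_ae_filter by auto
    have gm: "g \<in> borel_measurable Q1" "g \<in> borel_measurable Q2"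
      using g(1) measurable_cong_sets[OF sets(2) refl] measurable_cong_sets[OF sets(3) refl] by blast+
    have eq: "AE \<omega> in Q1. g1 \<omega> = g \<omega>" "AE \<omega> in Q2. g2 \<omega> = g \<omega>"
      using ae 1(3) 2(3) by (auto elim: AE_mp)
    have int: "integrable Q1 g" "integrable Q2 g"
      using integrable_cong_AE_imp[OF 1(2) gm(1)] integrable_cong_AE_imp[OF 2(2) gm(2)] eq by auto
    have "y = integral\<^sup>L Q1 g" "x = integral\<^sup>L Q2 g"
      unfolding 1(4) 2(4) by (intro integral_cong_AE eq gm borel_measurable_integrable 1(2) 2(2))+
    then have "integral\<^sup>L R g = (1 - s) *\<^sub>R y + s *\<^sub>R x"
      using integral_mixture(2)[OF mix sets t int] by (simp add: t_def)
    with momentsI[OF RD integral_mixture(1)[OF mix sets t int] g(2)] show ?thesis by simp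
  qed
qed

text \<open>Supplies the measures that rule out a separating hyperplane: for \<open>U\<close> the open half-space where \<open>a \<bullet> w > 0\<close>,
the resulting moment of \<open>W\<close> lies strictly on the wrong side.\<close>

lemma ex_dominated_concentrated:
  fixes W :: "'w::topological_space \<Rightarrow> 'e::euclidean_space"
  assumes probs: "\<P> \<subseteq> space (prob_algebra borel)" and P: "P \<in> \<P>"
    and W: "has_borel_versions W" and U: "open U"
    and pos: "\<not> (AE \<omega> in P. W \<omega> \<notin> U)"
  obtains Q g where "Q \<in> dominated \<P>" "integrable Q g" "AE \<omega> in Q. W \<omega> = g \<omega>"
    "AE \<omega> in Q. g \<omega> \<in> U"
proof -
  have Ps: "prob_space P" "sets P = sets borel" and Pp: "P \<in> space (prob_algebra borel)"
    using probs P by (auto simp: space_prob_algebra)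
  obtain g where g: "g \<in> borel_measurable borel" "AE \<omega> in P. W \<omega> = g \<omega>"
    using W Pp unfolding has_borel_versions_def by metis
  have gm: "g \<in> borel_measurable P"
    using g(1) measurable_cong_sets[OF Ps(2) refl] by blast
  have B: "g -` U \<in> sets P"
    using measurable_sets[OF g(1) borel_open[OF U]] Ps(2) by simp
  have "\<not> (AE \<omega> in P. \<omega> \<notin> g -` U)"
  proof
    assume "AE \<omega> in P. \<omega> \<notin> g -` U"
    with g(2) have "AE \<omega> in P. W \<omega> \<notin> U" by eventually_elim auto
    with pos show False by simp
  qed
  from prob_density_concentrated[OF Ps(1) gm B this]
  obtain Q where Q: "prob_space Q" "sets Q = sets P" "absolutely_continuous P Q" "integrable Q g"
    "AE x in Q. x \<in> g -` U" by metis
  show thesis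
  proof
    show "Q \<in> dominated \<P>" using Q Ps P by (auto simp: dominated_def space_prob_algebra)
    show "AE \<omega> in Q. W \<omega> = g \<omega>" using absolutely_continuous_AE[OF Q(2,3) g(2)] .
  qed (use Q in auto)
qed

text \<open>A theorem of the alternative: either some nonzero \<open>a \<in> C\<close> has \<open>a \<bullet> W \<le> 0\<close> quasi-surely, or the moments
of \<open>W\<close> meet the dual cone of \<open>C\<close>.  Separating \<open>0\<close> from the difference set \<open>C\<^sup>* - M\<close> suffices.  That set is
convex but in general not closed; in finite dimension convexity alone allows the separation.\<close>

proposition ex_moment_in_dual_cone:
  fixes W :: "'w::topological_space \<Rightarrow> 'e::euclidean_space"
  assumes probs: "\<P> \<subseteq> space (prob_algebra borel)" and ne: "\<P> \<noteq> {}" and conv: "convex_measures \<P>"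
    and W: "has_borel_versions W"
    and C: "convex C" "closed C" "cone C" "C \<noteq> {}"
    and no: "\<And>a. a \<in> C \<Longrightarrow> a \<noteq> 0 \<Longrightarrow> \<not> qs \<P> (\<lambda>\<omega>. a \<bullet> W \<omega> \<le> 0)"
  obtains m where "m \<in> moments \<P> W" "\<And>a. a \<in> C \<Longrightarrow> 0 \<le> a \<bullet> m"
proof -
  define K where "K = {v. \<forall>c\<in>C. 0 \<le> c \<bullet> v}"
  have K: "convex K"
    unfolding K_def convex_def by (auto simp: inner_add_right intro!: add_nonneg_nonneg mult_nonneg_nonneg)
  have "moments \<P> W \<inter> K \<noteq> {}"
  proof
    assume disj: "moments \<P> W \<inter> K = {}"
    define D where "D = (\<Union>v\<in>K. \<Union>m\<in>moments \<P> W. {v - m})"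
    have "convex D" unfolding D_def by (rule convex_differences[OF K convex_moments[OF probs conv W]])
    moreover have "0 \<notin> D" using disj by (auto simp: D_def)
    ultimately obtain a where "a \<noteq> 0" "\<forall>x\<in>D. 0 \<le> a \<bullet> x"
      using separating_hyperplane_set_0[of D] by metis
    then have a: "a \<noteq> 0" "\<And>v m. v \<in> K \<Longrightarrow> m \<in> moments \<P> W \<Longrightarrow> 0 \<le> a \<bullet> (v - m)"
      by (auto simp: D_def)
    have "0 \<in> K" by (simp add: K_def)
    then have am: "a \<bullet> m \<le> 0" if "m \<in> moments \<P> W" for m
      using a(2)[of 0 m] that by simp
    obtain P where P: "P \<in> \<P>" using ne by auto
    have "\<not> (AE \<omega> in P. W \<omega> \<notin> UNIV)"
      using probs P prob_space.AE_False by (auto simp: space_prob_algebra)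
    from ex_dominated_concentrated[OF probs P W open_UNIV this]
    obtain m0 where m0: "m0 \<in> moments \<P> W" unfolding moments_def by blast
    have "a \<in> C"
    proof (rule closed_convex_cone_bidual[OF C])
      fix v assume v: "\<And>c. c \<in> C \<Longrightarrow> 0 \<le> c \<bullet> v"
      show "0 \<le> a \<bullet> v"
      proof (rule ccontr)
        assume neg: "\<not> 0 \<le> a \<bullet> v"
        \<comment> \<open>With this factor, the supporting inequality at \<open>r v\<close> and \<open>m0\<close> reads \<open>0 \<le> -1\<close>.\<close>
        define r where "r = (a \<bullet> m0 - 1) / (a \<bullet> v)"
        have "r \<ge> 0" using neg am[OF m0] unfolding r_def by (simp add: divide_nonpos_neg)
        then have "r *\<^sub>R v \<in> K" using v by (simp add: K_def)
        from a(2)[OF this m0] show False using neg by (simp add: r_def inner_diff_right)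
      qed
    qed
    from no[OF this a(1)] obtain P where P: "P \<in> \<P>" "\<not> (AE \<omega> in P. W \<omega> \<notin> {w. 0 < a \<bullet> w})"
      unfolding qs_def by (auto simp: not_less)
    have "open {w. 0 < a \<bullet> w}" by (simp add: open_halfspace_gt)
    from ex_dominated_concentrated[OF probs P(1) W this P(2)]
    obtain Q g where Q: "Q \<in> dominated \<P>" "integrable Q g" "AE \<omega> in Q. W \<omega> = g \<omega>"
      "AE \<omega> in Q. 0 < a \<bullet> g \<omega>" by auto
    have "prob_space Q" using Q by (auto simp: dominated_def space_prob_algebra)
    then interpret Q: prob_space Q .
    have ge: "integral\<^sup>L Q g \<in> moments \<P> W" using Q by (auto simp: moments_def)
    have "(\<integral>\<omega>. a \<bullet> g \<omega> \<partial>Q) > 0"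
      using Q.expectation_less[of "\<lambda>\<omega>. - (a \<bullet> g \<omega>)" 0] Q(2,4) by auto
    then show False using am[OF ge] Q(2) by simp
  qed
  then show thesis using that unfolding K_def by blast
qed

section \<open>Homogenising the set of strategies\<close>

definition homogenization :: "'e::real_normed_vector set \<Rightarrow> ('e \<times> real) set"
  where "homogenization K = closure (cone hull (K \<times> {1}))"

lemma homogenization_closed_convex_cone:
  fixes K :: "'e::euclidean_space set"
  assumes "convex K" "K \<noteq> {}"
  shows "convex (homogenization K)" "closed (homogenization K)" "cone (homogenization K)"
    "homogenization K \<noteq> {}"
  using assms unfolding homogenization_def
  by (simp_all add: convex_closure convex_cone_hull convex_Times cone_closure cone_cone_hull
      cone_hull_empty_iff[symmetric])

lemma homogenization_lift: "k \<in> K \<Longrightarrow> (k, 1) \<in> homogenization K"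
  unfolding homogenization_def using closure_subset hull_subset[of "K \<times> {1}" cone] by fastforce

text \<open>An element is a limit of \<open>(c\<^sub>n k\<^sub>n, c\<^sub>n)\<close>.  If the limit \<open>t\<close> of \<open>c\<^sub>n\<close> is positive, then \<open>k\<^sub>n\<close> itself converges; if
it is zero, the strategies may escape to infinity, but \<open>c\<^sub>n k\<^sub>n\<close> still stays in the closed cone over \<open>K\<close>.\<close>

lemma homogenizationD:
  fixes K :: "'e::euclidean_space set"
  assumes K: "closed K" and C: "closed (cone hull K)" and ht: "(h, t) \<in> homogenization K"
  shows "h \<in> cone hull K" "0 \<le> t" "0 < t \<Longrightarrow> h /\<^sub>R t \<in> K"
proof -
  obtain y where y: "\<And>n. y n \<in> cone hull (K \<times> {1::real})" "y \<longlonglongrightarrow> (h, t)"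
    using ht unfolding homogenization_def closure_sequential by auto
  have "\<exists>c k. 0 \<le> c \<and> k \<in> K \<and> y n = (c *\<^sub>R k, c)" for n
    using y(1)[of n] unfolding cone_hull_expl by auto
  then obtain c k where ck: "\<And>n. 0 \<le> c n" "\<And>n. k n \<in> K" "\<And>n. y n = (c n *\<^sub>R k n, c n)"
    by metis
  have c: "c \<longlonglongrightarrow> t" using tendsto_snd[OF y(2)] by (simp add: ck(3))
  have h: "(\<lambda>n. c n *\<^sub>R k n) \<longlonglongrightarrow> h" using tendsto_fst[OF y(2)] by (simp add: ck(3))
  show "h \<in> cone hull K"
    using closed_sequentially[OF C _ h] ck by (simp add: mem_cone_hull)
  show "0 \<le> t" using c ck(1) by (intro LIMSEQ_le_const) auto
  assume t: "0 < t"
  have "(\<lambda>n. (c n *\<^sub>R k n) /\<^sub>R c n) \<longlonglongrightarrow> h /\<^sub>R t"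
    using h c t by (intro tendsto_intros) auto
  moreover have "\<forall>\<^sub>F n in sequentially. (c n *\<^sub>R k n) /\<^sub>R c n = k n"
    using order_tendstoD(1)[OF c t] by eventually_elim simp
  ultimately have "k \<longlonglongrightarrow> h /\<^sub>R t" by (rule Lim_transform_eventually)
  with ck(2) show "h /\<^sub>R t \<in> K" by (rule closed_sequentially[OF K])
qed

lemma qs_mono:
  assumes "qs \<P> \<phi>" "\<And>\<omega>. \<phi> \<omega> \<Longrightarrow> \<psi> \<omega>"
  shows "qs \<P> \<psi>"
  unfolding qs_def
proof
  fix P assume "P \<in> \<P>"
  then have "AE \<omega> in P. \<phi> \<omega>" using assms(1) by (simp add: qs_def)
  then show "AE \<omega> in P. \<psi> \<omega>" by eventually_elim (rule assms(2))
qed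

text \<open>Limits of sequences involve countably many exceptional null sets for each measure, and these can be united.\<close>

lemma closed_qs_nonpos: "closed {a. qs \<P> (\<lambda>\<omega>. a \<bullet> W \<omega> \<le> 0)}"
  unfolding closed_sequential_limits
proof (intro allI impI, elim conjE)
  fix a l assume a: "\<forall>n. a n \<in> {a. qs \<P> (\<lambda>\<omega>. a \<bullet> W \<omega> \<le> 0)}" and l: "a \<longlonglongrightarrow> l"
  have "AE \<omega> in P. l \<bullet> W \<omega> \<le> 0" if "P \<in> \<P>" for P
  proof -
    have "AE \<omega> in P. \<forall>n. a n \<bullet> W \<omega> \<le> 0"
      using a that by (simp add: AE_all_countable qs_def)
    then show ?thesis
    proof eventually_elim
      case (elim \<omega>)
      have "(\<lambda>n. a n \<bullet> W \<omega>) \<longlonglongrightarrow> l \<bullet> W \<omega>" by (intro tendsto_intros l)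
      then show ?case using elim by (intro LIMSEQ_le_const2) auto
    qed
  qed
  then show "l \<in> {a. qs \<P> (\<lambda>\<omega>. a \<bullet> W \<omega> \<le> 0)}" by (simp add: qs_def)
qed

text \<open>The vector \<open>W\<^sub>x\<close> of the introduction: its product with \<open>(k, 1)\<close> is the shortfall of the strategy \<open>k\<close>
started from capital \<open>x\<close>.\<close>

definition residual :: "('w \<Rightarrow> 'e) \<Rightarrow> ('w \<Rightarrow> real) \<Rightarrow> real \<Rightarrow> 'w \<Rightarrow> 'e::real_inner \<times> real"
  where "residual \<Delta>S f x \<omega> = (- \<Delta>S \<omega>, f \<omega> - x)"

lemma inner_residual: "(h, t) \<bullet> residual \<Delta>S f x \<omega> = t * (f \<omega> - x) - h \<bullet> \<Delta>S \<omega>"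
  by (simp add: residual_def)

section \<open>Existence of an optimal superhedge\<close>

text \<open>The case \<open>t = 0\<close> is where the absence of arbitrage enters: there the inequality says \<open>h \<bullet> \<Delta>S \<ge> 0\<close>.\<close>

lemma superhedge_of_homogenization:
  fixes K :: "'e::euclidean_space set"
  assumes K: "closed K" and C: "closed (cone hull K)"
    and NA: "\<And>h. h \<in> cone hull K \<Longrightarrow> qs \<P> (\<lambda>\<omega>. 0 \<le> h \<bullet> \<Delta>S \<omega>) \<Longrightarrow> h = 0"
    and a: "(h, t) \<in> homogenization K" "(h, t) \<noteq> 0"
    and le: "qs \<P> (\<lambda>\<omega>. (h, t) \<bullet> residual \<Delta>S f x \<omega> \<le> 0)"
  shows "h /\<^sub>R t \<in> K" "qs \<P> (\<lambda>\<omega>. f \<omega> \<le> x + (h /\<^sub>R t) \<bullet> \<Delta>S \<omega>)"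
proof -
  have "t \<noteq> 0"
  proof
    assume t: "t = 0"
    then have "h = 0"
      using homogenizationD(1)[OF K C a(1)] le by (intro NA) (simp_all add: inner_residual)
    with t a(2) show False by (simp add: zero_prod_def)
  qed
  then have t: "0 < t" using homogenizationD(2)[OF K C a(1)] by simp
  then show "h /\<^sub>R t \<in> K" by (rule homogenizationD(3)[OF K C a(1)])
  have "f \<omega> \<le> x + (h /\<^sub>R t) \<bullet> \<Delta>S \<omega>" if "(h, t) \<bullet> residual \<Delta>S f x \<omega> \<le> 0" for \<omega>
    using that t by (simp add: inner_residual field_simps)
  with le show "qs \<P> (\<lambda>\<omega>. f \<omega> \<le> x + (h /\<^sub>R t) \<bullet> \<Delta>S \<omega>)" by (rule qs_mono)
qed

text \<open>The infimum of \<open>X\<close> is already the infimum of a countable part of \<open>X\<close>.\<close>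

lemma qs_le_Inf:
  fixes X :: "real set" and g :: "'w \<Rightarrow> real"
  assumes "X \<noteq> {}" "\<And>x. x \<in> X \<Longrightarrow> qs \<P> (\<lambda>\<omega>. g \<omega> \<le> x)"
  shows "qs \<P> (\<lambda>\<omega>. ereal (g \<omega>) \<le> Inf (ereal ` X))"
proof -
  obtain y :: "nat \<Rightarrow> ereal" where y: "range y \<subseteq> ereal ` X" "Inf (ereal ` X) = (INF n. y n)"
    using Inf_countable_INF[of "ereal ` X"] assms(1) by auto
  have "AE \<omega> in P. ereal (g \<omega>) \<le> y n" if P: "P \<in> \<P>" for P n
  proof -
    obtain x where "x \<in> X" "y n = ereal x" using y(1) by blast
    then show ?thesis using assms(2)[of x] P by (simp add: qs_def)
  qed
  then have "AE \<omega> in P. \<forall>n. ereal (g \<omega>) \<le> y n" if P: "P \<in> \<P>" for P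
    using that by (simp add: AE_all_countable)
  then show ?thesis unfolding qs_def y(2) by (simp add: le_INF_iff)
qed

text \<open>A common superhedge for all sufficient capitals is found as a common point of a chain of nonempty
compact sets of unit vectors.  The conclusion bounds the real-valued \<open>f - k \<bullet> \<Delta>S\<close> by the infimum,
which therefore cannot be \<open>-\<infinity>\<close> as soon as there is a probability measure in \<open>\<P>\<close>.\<close>

proposition superhedge_attained:
  fixes K :: "'e::euclidean_space set" and f :: "'w \<Rightarrow> real"
  assumes K: "closed K" and C: "closed (cone hull K)" and "convex K"
    and NA: "\<And>h. h \<in> cone hull K \<Longrightarrow> qs \<P> (\<lambda>\<omega>. 0 \<le> h \<bullet> \<Delta>S \<omega>) \<Longrightarrow> h = 0"
    and X: "X = {x. \<exists>k\<in>K. qs \<P> (\<lambda>\<omega>. f \<omega> \<le> x + k \<bullet> \<Delta>S \<omega>)}" and ne: "X \<noteq> {}"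
  obtains k where "k \<in> K" "qs \<P> (\<lambda>\<omega>. ereal (f \<omega> - k \<bullet> \<Delta>S \<omega>) \<le> Inf (ereal ` X))"
proof -
  have "K \<noteq> {}" using ne X by auto
  note hom = homogenization_closed_convex_cone[OF \<open>convex K\<close> this]
  define G where "G x = homogenization K \<inter> sphere 0 1 \<inter> {a. qs \<P> (\<lambda>\<omega>. a \<bullet> residual \<Delta>S f x \<omega> \<le> 0)}" for x
  have cpt: "compact (G x)" for x
    unfolding G_def by (intro compact_Int_closed closed_Int_compact hom(2) compact_sphere closed_qs_nonpos)
  have nonempty: "G x \<noteq> {}" if "x \<in> X" for x
  proof -
    obtain k where k: "k \<in> K" "qs \<P> (\<lambda>\<omega>. f \<omega> \<le> x + k \<bullet> \<Delta>S \<omega>)" using \<open>x \<in> X\<close> X by auto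
    let ?r = "inverse (norm (k, 1::real))"
    have r: "?r > 0" by (simp add: zero_prod_def)
    have "?r *\<^sub>R (k, 1) \<in> homogenization K"
      by (rule mem_cone[OF hom(3) homogenization_lift[OF k(1)]]) (use r in simp)
    moreover have "?r *\<^sub>R (k, 1::real) \<in> sphere 0 1"
      using r unfolding mem_sphere_0 norm_scaleR by simp
    moreover have "(?r *\<^sub>R (k, 1)) \<bullet> residual \<Delta>S f x \<omega> \<le> 0" if "f \<omega> \<le> x + k \<bullet> \<Delta>S \<omega>" for \<omega>
      using that r unfolding inner_scaleR_left inner_residual by (intro mult_nonneg_nonpos) auto
    with k(2) have "qs \<P> (\<lambda>\<omega>. (?r *\<^sub>R (k, 1)) \<bullet> residual \<Delta>S f x \<omega> \<le> 0)"
      by (rule qs_mono)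
    ultimately show ?thesis unfolding G_def by blast
  qed
  have mono: "G x \<subseteq> G y" if "x \<le> y" for x y
  proof
    fix a assume a: "a \<in> G x"
    obtain h t where ht: "a = (h, t)" by (cases a)
    have t: "0 \<le> t" using a homogenizationD(2)[OF K C] by (auto simp: G_def ht)
    have "(h, t) \<bullet> residual \<Delta>S f y \<omega> \<le> 0" if "(h, t) \<bullet> residual \<Delta>S f x \<omega> \<le> 0" for \<omega>
      using that mult_left_mono[OF \<open>x \<le> y\<close> t] by (simp add: inner_residual algebra_simps)
    moreover have "qs \<P> (\<lambda>\<omega>. (h, t) \<bullet> residual \<Delta>S f x \<omega> \<le> 0)" using a by (simp add: G_def ht)
    ultimately have "qs \<P> (\<lambda>\<omega>. (h, t) \<bullet> residual \<Delta>S f y \<omega> \<le> 0)" by (blast intro: qs_mono)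
    then show "a \<in> G y" using a by (simp add: G_def ht)
  qed
  have chain: "G x \<subseteq> G y \<or> G y \<subseteq> G x" for x y using mono[of x y] mono[of y x] by linarith
  have "\<Inter>(G ` X) \<noteq> {}"
  proof (rule compact_chain)
    show "compact S" if "S \<in> G ` X" for S using that cpt by auto
    show "{} \<notin> G ` X" using nonempty by auto
    show "S \<subseteq> T \<or> T \<subseteq> S" if "S \<in> G ` X \<and> T \<in> G ` X" for S T using that chain by auto
  qed
  then obtain a where "a \<in> \<Inter>(G ` X)" by blast
  then obtain h t where ht: "\<And>x. x \<in> X \<Longrightarrow> (h, t) \<in> G x" by (cases a) auto
  have k: "h /\<^sub>R t \<in> K" "qs \<P> (\<lambda>\<omega>. f \<omega> \<le> x + (h /\<^sub>R t) \<bullet> \<Delta>S \<omega>)" if "x \<in> X" for x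
  proof -
    have a: "(h, t) \<in> homogenization K" "(h, t) \<noteq> 0"
        "qs \<P> (\<lambda>\<omega>. (h, t) \<bullet> residual \<Delta>S f x \<omega> \<le> 0)"
      using ht[OF that] by (auto simp: G_def)
    show "h /\<^sub>R t \<in> K" "qs \<P> (\<lambda>\<omega>. f \<omega> \<le> x + (h /\<^sub>R t) \<bullet> \<Delta>S \<omega>)"
      using superhedge_of_homogenization[OF K C NA a] by auto
  qed
  show thesis
  proof
    show "h /\<^sub>R t \<in> K" using ne k(1) by auto
    show "qs \<P> (\<lambda>\<omega>. ereal (f \<omega> - (h /\<^sub>R t) \<bullet> \<Delta>S \<omega>) \<le> Inf (ereal ` X))"
      using k(2) by (intro qs_le_Inf[OF ne]) (simp add: algebra_simps)
  qed
qed

section \<open>Extended expectations\<close>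

text \<open>If both parts of \<open>Y\<close> have infinite integral, then so has the negative part
of \<open>X\<close>, and both expectations are \<open>-\<infinity>\<close>.\<close>

lemma ext_expect_mono:
  assumes "AE \<omega> in Q. X \<omega> \<le> Y \<omega>"
  shows "ext_expect Q X \<le> ext_expect Q Y"
proof -
  have "(\<integral>\<^sup>+\<omega>. ennreal (X \<omega>) \<partial>Q) \<le> (\<integral>\<^sup>+\<omega>. ennreal (Y \<omega>) \<partial>Q)"
    and "(\<integral>\<^sup>+\<omega>. ennreal (- Y \<omega>) \<partial>Q) \<le> (\<integral>\<^sup>+\<omega>. ennreal (- X \<omega>) \<partial>Q)"
    using assms by (auto intro!: nn_integral_mono_AE ennreal_leI elim!: AE_mp)
  then show ?thesis
    unfolding ext_expect_def Let_def nn_integral_completion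
    by (cases "\<integral>\<^sup>+\<omega>. ennreal (X \<omega>) \<partial>Q")
      (auto simp: less_eq_ennreal.rep_eq enn2ereal_ennreal intro!: ereal_minus_mono)
qed

lemma ext_expect_eq_integral:
  assumes "integrable Q g" "AE \<omega> in Q. X \<omega> = g \<omega>"
  shows "ext_expect Q X = ereal (integral\<^sup>L Q g)"
proof -
  have *: "(\<integral>\<^sup>+\<omega>. ennreal (X \<omega>) \<partial>Q) = (\<integral>\<^sup>+\<omega>. ennreal (g \<omega>) \<partial>Q)"
    "(\<integral>\<^sup>+\<omega>. ennreal (- X \<omega>) \<partial>Q) = (\<integral>\<^sup>+\<omega>. ennreal (- g \<omega>) \<partial>Q)"
    using assms(2) by (auto intro!: nn_integral_cong_AE)
  have "enn2ereal p = ereal (enn2real p)" if "p \<noteq> \<infinity>" for p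
    using that by (cases p) auto
  then show ?thesis
    using assms(1) unfolding ext_expect_def Let_def nn_integral_completion * real_lebesgue_integral_def[OF assms(1)]
    by (simp add: real_integrable_def)
qed

lemma integrable_if_ext_expect_norm:
  fixes D :: "'w \<Rightarrow> 'e::euclidean_space"
  assumes "D \<in> borel_measurable Q" "ext_expect Q (\<lambda>\<omega>. norm (D \<omega>)) < \<infinity>"
  shows "integrable Q D"
proof -
  have "(\<integral>\<^sup>+\<omega>. ennreal (norm (D \<omega>)) \<partial>Q) < \<infinity>"
    using assms(2) unfolding ext_expect_def nn_integral_completion
    by (cases "(\<integral>\<^sup>+\<omega>. ennreal (norm (D \<omega>)) \<partial>Q)") (auto simp: ennreal_neg)
  then show ?thesis using assms(1) by (simp add: integrable_iff_bounded)
qed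

section \<open>Projected strategies\<close>

lemma C_cone_eq_cone_hull: "C_cone \<P> \<H> \<Delta>S = cone hull (H_proj \<P> \<H> \<Delta>S)"
  unfolding C_cone_def cone_hull_expl by blast

text \<open>The projection removes a component orthogonal to the support, where \<open>\<Delta>S\<close> lives.\<close>

lemma qs_inner_orth_proj:
  fixes \<Delta>S :: "'w \<Rightarrow> 'e::euclidean_space"
  shows "qs \<P> (\<lambda>\<omega>. orth_proj (N_perp \<P> \<Delta>S) H \<bullet> \<Delta>S \<omega> = H \<bullet> \<Delta>S \<omega>)"
proof -
  have V: "subspace (N_perp \<P> \<Delta>S)" by (simp add: N_perp_def)
  have "orth_proj (N_perp \<P> \<Delta>S) H \<bullet> s = H \<bullet> s" if "s \<in> qs_support \<P> \<Delta>S" for s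
    using orth_proj_orthogonal[OF V, of s H] that
    by (simp add: N_perp_def span_base orthogonal_def inner_diff_left)
  with qs_in_qs_support[of \<P> \<Delta>S] show ?thesis by (rule qs_mono)
qed

text \<open>A hyperplane that contains \<open>\<Delta>S\<close> quasi-surely contains the support and its span, so \<open>h\<close> is orthogonal to itself.\<close>

lemma N_perp_eq_0:
  assumes h: "h \<in> N_perp \<P> \<Delta>S" and "qs \<P> (\<lambda>\<omega>. h \<bullet> \<Delta>S \<omega> = 0)"
  shows "h = 0"
proof -
  have "qs_support \<P> \<Delta>S \<subseteq> {s. h \<bullet> s = 0}"
    using assms(2) by (intro qs_support_least closed_hyperplane) simp
  then have "span (qs_support \<P> \<Delta>S) \<subseteq> {s. h \<bullet> s = 0}"
    by (rule span_minimal) (rule subspace_hyperplane)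
  then show ?thesis using h by (auto simp: N_perp_def)
qed

text \<open>The strategies in \<open>\<H>\<close> can be degenerate, with zero gain but \<open>H \<noteq> 0\<close>; after projection they are not.
This strict form of the absence of arbitrage is what the compactness and separation arguments use.\<close>

lemma no_arbitrage_cone:
  fixes \<Delta>S :: "'w \<Rightarrow> 'e::euclidean_space"
  assumes NA: "no_arbitrage \<P> \<H> \<Delta>S" and h: "h \<in> cone hull (H_proj \<P> \<H> \<Delta>S)"
    and nonneg: "qs \<P> (\<lambda>\<omega>. 0 \<le> h \<bullet> \<Delta>S \<omega>)"
  shows "h = 0"
proof -
  let ?pr = "orth_proj (N_perp \<P> \<Delta>S)"
  obtain c H where c: "0 \<le> c" and H: "H \<in> \<H>" and hc: "h = c *\<^sub>R ?pr H"
    using h unfolding cone_hull_expl H_proj_def by auto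
  show ?thesis
  proof (cases "c = 0")
    case False
    with c have c: "0 < c" by simp
    have "qs \<P> (\<lambda>\<omega>. 0 \<le> H \<bullet> \<Delta>S \<omega>)"
      unfolding qs_def
    proof
      fix P assume P: "P \<in> \<P>"
      have "AE \<omega> in P. ?pr H \<bullet> \<Delta>S \<omega> = H \<bullet> \<Delta>S \<omega>" "AE \<omega> in P. 0 \<le> h \<bullet> \<Delta>S \<omega>"
        using qs_inner_orth_proj[of \<P> \<Delta>S H] nonneg P by (auto simp: qs_def)
      then show "AE \<omega> in P. 0 \<le> H \<bullet> \<Delta>S \<omega>"
        by eventually_elim (use c in \<open>simp add: hc zero_le_mult_iff\<close>)
    qed
    then have zero: "qs \<P> (\<lambda>\<omega>. H \<bullet> \<Delta>S \<omega> = 0)" using NA H by (simp add: no_arbitrage_def)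
    have "qs \<P> (\<lambda>\<omega>. ?pr H \<bullet> \<Delta>S \<omega> = 0)"
      unfolding qs_def
    proof
      fix P assume P: "P \<in> \<P>"
      have "AE \<omega> in P. ?pr H \<bullet> \<Delta>S \<omega> = H \<bullet> \<Delta>S \<omega>" "AE \<omega> in P. H \<bullet> \<Delta>S \<omega> = 0"
        using qs_inner_orth_proj[of \<P> \<Delta>S H] zero P by (auto simp: qs_def)
      then show "AE \<omega> in P. ?pr H \<bullet> \<Delta>S \<omega> = 0" by eventually_elim simp
    qed
    moreover have "?pr H \<in> N_perp \<P> \<Delta>S" by (rule orth_proj_in) (simp add: N_perp_def)
    ultimately show ?thesis using N_perp_eq_0 hc by fastforce
  qed (simp add: hc)
qed

lemma superhedge_proj_iff:
  fixes \<Delta>S :: "'w \<Rightarrow> 'e::euclidean_space"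
  shows "qs \<P> (\<lambda>\<omega>. f \<omega> \<le> x + orth_proj (N_perp \<P> \<Delta>S) H \<bullet> \<Delta>S \<omega>)
    \<longleftrightarrow> qs \<P> (\<lambda>\<omega>. f \<omega> \<le> x + H \<bullet> \<Delta>S \<omega>)"
proof -
  have "(AE \<omega> in P. f \<omega> \<le> x + orth_proj (N_perp \<P> \<Delta>S) H \<bullet> \<Delta>S \<omega>)
      \<longleftrightarrow> (AE \<omega> in P. f \<omega> \<le> x + H \<bullet> \<Delta>S \<omega>)" if "P \<in> \<P>" for P
    using qs_inner_orth_proj[of \<P> \<Delta>S H] that by (intro eventually_cong) (auto simp: qs_def elim: AE_mp)
  then show ?thesis by (simp add: qs_def)
qed

lemma superhedging_price_eq_H_proj:
  fixes \<Delta>S :: "'w \<Rightarrow> 'e::euclidean_space"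
  shows "superhedging_price \<P> \<H> \<Delta>S f =
    Inf (ereal ` {x. \<exists>k\<in>H_proj \<P> \<H> \<Delta>S. qs \<P> (\<lambda>\<omega>. f \<omega> \<le> x + k \<bullet> \<Delta>S \<omega>)})"
  unfolding superhedging_price_def H_proj_def by (simp add: superhedge_proj_iff)

section \<open>Duality\<close>

text \<open>Take expectations in \<open>f \<le> x + H \<bullet> \<Delta>S\<close>.  The right-hand side is integrable under a dual measure,
while \<open>f\<close> may have expectation \<open>-\<infinity>\<close>.\<close>

lemma weak_duality:
  fixes \<Delta>S :: "'w::topological_space \<Rightarrow> 'e::euclidean_space"
  assumes probs: "\<P> \<subseteq> space (prob_algebra borel)" and meas: "\<Delta>S \<in> borel_measurable borel"
    and Q: "Q \<in> dual_measures \<P> \<H> \<Delta>S"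
  shows "ext_expect Q f - penalty \<H> \<Delta>S Q \<le> superhedging_price \<P> \<H> \<Delta>S f"
  unfolding superhedging_price_def
proof (rule Inf_greatest, clarify)
  fix x H assume H: "H \<in> \<H>" and sh: "qs \<P> (\<lambda>\<omega>. f \<omega> \<le> x + H \<bullet> \<Delta>S \<omega>)"
  have Qd: "Q \<in> dominated \<P>" and pen: "penalty \<H> \<Delta>S Q < \<infinity>"
    and fin: "ext_expect Q (\<lambda>\<omega>. norm (\<Delta>S \<omega>)) < \<infinity>"
    using Q by (auto simp: dual_measures_def dominated_def)
  have sets: "sets Q = sets borel" and "prob_space Q"
    using Qd by (auto simp: dominated_def space_prob_algebra)
  then interpret Q: prob_space Q by simp
  have int: "integrable Q \<Delta>S"
    using fin meas measurable_cong_sets[OF sets refl] by (intro integrable_if_ext_expect_norm) blast+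
  let ?e = "integral\<^sup>L Q \<Delta>S"
  have EH: "ext_expect Q (\<lambda>\<omega>. H \<bullet> \<Delta>S \<omega>) = ereal (H \<bullet> ?e)"
    using ext_expect_eq_integral[of Q "\<lambda>\<omega>. H \<bullet> \<Delta>S \<omega>" "\<lambda>\<omega>. H \<bullet> \<Delta>S \<omega>"] int by simp
  have "ext_expect Q f \<le> ext_expect Q (\<lambda>\<omega>. x + H \<bullet> \<Delta>S \<omega>)"
    by (rule ext_expect_mono[OF dominated_AE[OF Qd probs sh]])
  also have "\<dots> = ereal (\<integral>\<omega>. x + H \<bullet> \<Delta>S \<omega> \<partial>Q)"
    using int by (intro ext_expect_eq_integral) auto
  also have "\<dots> = ereal x + ereal (H \<bullet> ?e)"
    using int by (simp add: Q.prob_space)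
  finally have le: "ext_expect Q f \<le> ereal x + ereal (H \<bullet> ?e)" .
  have low: "ereal (H \<bullet> ?e) \<le> penalty \<H> \<Delta>S Q"
    unfolding penalty_def EH[symmetric] using H by (rule SUP_upper)
  then obtain p where p: "penalty \<H> \<Delta>S Q = ereal p" using pen by (cases "penalty \<H> \<Delta>S Q") auto
  have "ext_expect Q f \<le> ereal x + ereal p"
    using le low add_left_mono order_trans unfolding p by blast
  then show "ext_expect Q f - penalty \<H> \<Delta>S Q \<le> ereal x"
    unfolding p by (simp add: ereal_minus_le)
qed

lemma has_borel_versions_residual:
  fixes \<Delta>S :: "'w::topological_space \<Rightarrow> 'e::euclidean_space"
  assumes f: "universally_measurable f" and meas: "\<Delta>S \<in> borel_measurable borel"
  shows "has_borel_versions (residual \<Delta>S f x)"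
  unfolding has_borel_versions_def
proof
  fix Q :: "'w measure" assume Q: "Q \<in> space (prob_algebra borel)"
  then obtain g where g: "g \<in> borel_measurable Q" "AE \<omega> in Q. f \<omega> = g \<omega>"
    using f completion_ex_borel_measurable_real unfolding universally_measurable_def by metis
  have "sets Q = sets borel" using Q by (simp add: space_prob_algebra)
  then have gb: "g \<in> borel_measurable borel" using g(1) measurable_cong_sets by blast
  show "\<exists>r\<in>borel_measurable borel. AE \<omega> in Q. residual \<Delta>S f x \<omega> = r \<omega>"
  proof
    show "(\<lambda>\<omega>. (- \<Delta>S \<omega>, g \<omega> - x)) \<in> borel_measurable borel"
      using gb meas by measurable
    show "AE \<omega> in Q. residual \<Delta>S f x \<omega> = (- \<Delta>S \<omega>, g \<omega> - x)"
      using g(2) by (auto simp: residual_def)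
  qed
qed

text \<open>Apply the theorem of the alternative to \<open>W\<^sub>x\<close> and the homogenisation of \<open>K\<close>.  The measure obtained has
\<open>E\<^sub>Q[f] = x + snd m\<close> and \<open>E\<^sub>Q[\<Delta>S] = - fst m\<close>, and \<open>m\<close> lying in the dual cone bounds the penalty by \<open>snd m\<close>.\<close>

proposition dual_measure_above:
  fixes \<Delta>S :: "'w::topological_space \<Rightarrow> 'e::euclidean_space"
  assumes probs: "\<P> \<subseteq> space (prob_algebra borel)" and ne: "\<P> \<noteq> {}" and conv: "convex_measures \<P>"
    and meas: "\<Delta>S \<in> borel_measurable borel" and Hne: "\<H> \<noteq> {}"
    and f: "universally_measurable f"
    and C: "closed (C_cone \<P> \<H> \<Delta>S)"
    and K: "convex (H_proj \<P> \<H> \<Delta>S)" "closed (H_proj \<P> \<H> \<Delta>S)"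
    and NA: "no_arbitrage \<P> \<H> \<Delta>S"
    and x: "ereal x < superhedging_price \<P> \<H> \<Delta>S f"
  obtains Q where "Q \<in> dual_measures \<P> \<H> \<Delta>S" "ereal x \<le> ext_expect Q f - penalty \<H> \<Delta>S Q"
proof -
  let ?K = "H_proj \<P> \<H> \<Delta>S"
  let ?W = "residual \<Delta>S f x"
  have Kne: "?K \<noteq> {}" using Hne by (simp add: H_proj_def)
  note C' = C[unfolded C_cone_eq_cone_hull]
  have no: "\<not> qs \<P> (\<lambda>\<omega>. a \<bullet> ?W \<omega> \<le> 0)" if a: "a \<in> homogenization ?K" "a \<noteq> 0" for a
  proof
    assume le: "qs \<P> (\<lambda>\<omega>. a \<bullet> ?W \<omega> \<le> 0)"
    obtain h t where ht: "a = (h, t)" by (cases a)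
    have "\<exists>k\<in>?K. qs \<P> (\<lambda>\<omega>. f \<omega> \<le> x + k \<bullet> \<Delta>S \<omega>)"
      using superhedge_of_homogenization[OF K(2) C' no_arbitrage_cone[OF NA]
          a[unfolded ht] le[unfolded ht]] by blast
    then have "superhedging_price \<P> \<H> \<Delta>S f \<le> ereal x"
      unfolding superhedging_price_eq_H_proj by (intro Inf_lower) blast
    with x show False by simp
  qed
  from ex_moment_in_dual_cone[OF probs ne conv has_borel_versions_residual[OF f meas]
      homogenization_closed_convex_cone[OF K(1) Kne] no]
  obtain m where m: "m \<in> moments \<P> ?W" "\<And>a. a \<in> homogenization ?K \<Longrightarrow> 0 \<le> a \<bullet> m" by metis
  obtain Q g where Qd: "Q \<in> dominated \<P>" and g: "integrable Q g" "AE \<omega> in Q. ?W \<omega> = g \<omega>"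
    and mg: "m = integral\<^sup>L Q g"
    using m(1) unfolding moments_def by blast
  have "prob_space Q"
    using Qd by (auto simp: dominated_def space_prob_algebra)
  then interpret Q: prob_space Q by simp
  have i1: "integrable Q (\<lambda>\<omega>. fst (g \<omega>))" and i2: "integrable Q (\<lambda>\<omega>. snd (g \<omega>))"
    using g(1) by (auto intro: integrable_bounded_linear bounded_linear_fst bounded_linear_snd)
  have m1: "fst m = (\<integral>\<omega>. fst (g \<omega>) \<partial>Q)" and m2: "snd m = (\<integral>\<omega>. snd (g \<omega>) \<partial>Q)"
    unfolding mg by (simp_all add: integral_bounded_linear[OF bounded_linear_fst g(1)]
        integral_bounded_linear[OF bounded_linear_snd g(1)])
  have aeg: "AE \<omega> in Q. g \<omega> = (- \<Delta>S \<omega>, f \<omega> - x)"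
    using g(2) by eventually_elim (simp add: residual_def)
  have aeS: "AE \<omega> in Q. \<Delta>S \<omega> = - fst (g \<omega>)" using aeg by eventually_elim simp
  have aef: "AE \<omega> in Q. f \<omega> = snd (g \<omega>) + x" using aeg by eventually_elim simp
  have Ef: "ext_expect Q f = ereal (snd m + x)"
    using ext_expect_eq_integral[OF _ aef] i2 by (simp add: m2 Q.prob_space)
  have aeN: "AE \<omega> in Q. norm (\<Delta>S \<omega>) = norm (fst (g \<omega>))" using aeS by auto
  have ES: "ext_expect Q (\<lambda>\<omega>. norm (\<Delta>S \<omega>)) < \<infinity>"
    using ext_expect_eq_integral[OF _ aeN] i1 by simp
  have pen: "penalty \<H> \<Delta>S Q \<le> ereal (snd m)"
    unfolding penalty_def
  proof (rule SUP_least)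
    fix H assume H: "H \<in> \<H>"
    let ?k = "orth_proj (N_perp \<P> \<Delta>S) H"
    have k: "?k \<in> ?K" using H by (simp add: H_proj_def)
    have ae: "AE \<omega> in Q. H \<bullet> \<Delta>S \<omega> = - (?k \<bullet> fst (g \<omega>))"
      using aeS dominated_AE[OF Qd probs qs_inner_orth_proj[of \<P> \<Delta>S H]]
      by eventually_elim (metis inner_minus_right)
    have "ext_expect Q (\<lambda>\<omega>. H \<bullet> \<Delta>S \<omega>) = ereal (- (?k \<bullet> fst m))"
      using ext_expect_eq_integral[OF _ ae] i1 by (simp add: m1)
    moreover have "0 \<le> (?k, 1) \<bullet> m" by (rule m(2)[OF homogenization_lift[OF k]])
    ultimately show "ext_expect Q (\<lambda>\<omega>. H \<bullet> \<Delta>S \<omega>) \<le> ereal (snd m)"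
      by (simp add: inner_prod_def)
  qed
  show thesis
  proof
    show "Q \<in> dual_measures \<P> \<H> \<Delta>S"
      using Qd ES pen by (auto simp: dual_measures_def dominated_def)
    have "ereal x = ereal (snd m + x) - ereal (snd m)" by simp
    also have "\<dots> \<le> ext_expect Q f - penalty \<H> \<Delta>S Q"
      unfolding Ef using pen by (intro ereal_minus_mono) auto
    finally show "ereal x \<le> ext_expect Q f - penalty \<H> \<Delta>S Q" .
  qed
qed

theorem theorem4p1:
  fixes \<P> :: "'w::polish_space measure set"
    and S0 :: "real ^ 'd" and S1 \<Delta>S :: "'w \<Rightarrow> real ^ 'd"
    and \<H> :: "(real ^ 'd) set" and f :: "'w \<Rightarrow> real"
  assumes "\<P> \<subseteq> space (prob_algebra borel)" and "\<P> \<noteq> {}" and "convex_measures \<P>"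
    and "S1 \<in> borel_measurable borel" and "\<Delta>S = (\<lambda>\<omega>. S1 \<omega> - S0)"
    and "\<H> \<noteq> {}"
    and "universally_measurable f"
    and "closed (C_cone \<P> \<H> \<Delta>S)"
    and "convex (H_proj \<P> \<H> \<Delta>S)" and "closed (H_proj \<P> \<H> \<Delta>S)"
    and "no_arbitrage \<P> \<H> \<Delta>S"
  shows "superhedging_price \<P> \<H> \<Delta>S f =
           (SUP Q\<in>dual_measures \<P> \<H> \<Delta>S. ext_expect Q f - penalty \<H> \<Delta>S Q)
       \<and> superhedging_price \<P> \<H> \<Delta>S f > -\<infinity>
       \<and> (\<exists>H\<in>\<H>. qs \<P> (\<lambda>\<omega>. superhedging_price \<P> \<H> \<Delta>S f + ereal (H \<bullet> \<Delta>S \<omega>) \<ge> ereal (f \<omega>)))"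
    (is "?\<pi> = ?D \<and> _ \<and> _")
proof -
  have meas: "\<Delta>S \<in> borel_measurable borel" using assms(4) unfolding assms(5) by measurable
  have "?\<pi> = ?D"
  proof (rule antisym)
    show "?D \<le> ?\<pi>" by (rule SUP_least) (rule weak_duality[OF assms(1) meas])
    show "?\<pi> \<le> ?D"
    proof (rule ccontr)
      assume "\<not> ?\<pi> \<le> ?D"
      then obtain x where x: "?D < ereal x" "ereal x < ?\<pi>"
        using ereal_dense2[of ?D ?\<pi>] by (auto simp: not_le)
      obtain Q where Q: "Q \<in> dual_measures \<P> \<H> \<Delta>S" "ereal x \<le> ext_expect Q f - penalty \<H> \<Delta>S Q"
        using dual_measure_above[OF assms(1-3) meas assms(6-11) x(2)] by metis
      have "ereal x \<le> ?D" using Q by (rule SUP_upper2)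
      with x(1) show False by simp
    qed
  qed
  moreover have "?\<pi> > -\<infinity> \<and> (\<exists>H\<in>\<H>. qs \<P> (\<lambda>\<omega>. ?\<pi> + ereal (H \<bullet> \<Delta>S \<omega>) \<ge> ereal (f \<omega>)))"
  proof (cases "{x. \<exists>k\<in>H_proj \<P> \<H> \<Delta>S. qs \<P> (\<lambda>\<omega>. f \<omega> \<le> x + k \<bullet> \<Delta>S \<omega>)} = {}")
    case True
    then have "?\<pi> = \<infinity>" unfolding superhedging_price_eq_H_proj True by (simp add: top_ereal_def)
    then show ?thesis using assms(6) by (auto simp: qs_def)
  next
    case False
    from superhedge_attained[OF assms(10) assms(8)[unfolded C_cone_eq_cone_hull] assms(9)
        no_arbitrage_cone[OF assms(11)] refl False]
    obtain k where k: "k \<in> H_proj \<P> \<H> \<Delta>S" "qs \<P> (\<lambda>\<omega>. ereal (f \<omega> - k \<bullet> \<Delta>S \<omega>) \<le> ?\<pi>)"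
      unfolding superhedging_price_eq_H_proj[symmetric] .
    then obtain H where H: "H \<in> \<H>" and
      le: "qs \<P> (\<lambda>\<omega>. ereal (f \<omega> - orth_proj (N_perp \<P> \<Delta>S) H \<bullet> \<Delta>S \<omega>) \<le> ?\<pi>)"
      by (auto simp: H_proj_def)
    obtain P where P: "P \<in> \<P>" using assms(2) by auto
    then have "prob_space P" using assms(1) by (auto simp: space_prob_algebra)
    moreover have "qs \<P> (\<lambda>\<omega>. ?\<pi> \<noteq> -\<infinity>)"
      using le by (rule qs_mono) auto
    ultimately have "?\<pi> \<noteq> -\<infinity>"
      using P prob_space.AE_const[of P "?\<pi> \<noteq> -\<infinity>"] by (simp add: qs_def)
    moreover have "qs \<P> (\<lambda>\<omega>. ereal (f \<omega>) \<le> ?\<pi> + ereal (H \<bullet> \<Delta>S \<omega>))"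
      unfolding qs_def
    proof
      fix P assume "P \<in> \<P>"
      then have "AE \<omega> in P. ereal (f \<omega> - orth_proj (N_perp \<P> \<Delta>S) H \<bullet> \<Delta>S \<omega>) \<le> ?\<pi>"
        "AE \<omega> in P. orth_proj (N_perp \<P> \<Delta>S) H \<bullet> \<Delta>S \<omega> = H \<bullet> \<Delta>S \<omega>"
        using le qs_inner_orth_proj[of \<P> \<Delta>S H] by (auto simp: qs_def)
      then show "AE \<omega> in P. ereal (f \<omega>) \<le> ?\<pi> + ereal (H \<bullet> \<Delta>S \<omega>)"
        by eventually_elim (cases ?\<pi>, auto)
    qed
    ultimately show ?thesis using H by auto
  qed
  ultimately show ?thesis by blast
qed

end
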